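(* Fix a feedforward signal-to-noise ratio $\mathrm{snr}>0$, a feedback signal-to-noise ratio $\widetilde{\mathrm{snr}}$ with $\Delta:=\widetilde{\mathrm{snr}}/\mathrm{snr}>1$, a target error probability $p_e\in(0,1)$ and a number of rounds $N\ge 1$. Set $$L=\tfrac13\left[Q^{-1}\!\left(\tfrac{p_e}{4N}\right)\right]^2,$$ and assume $L<\widetilde{\mathrm{snr}}$. Run the scalar modulo scheme (described in the context) with the parameters $$\alpha=\sqrt{L\,P/\widetilde P},\qquad \gamma_n=\frac{1}{\sigma_n}\sqrt{\frac{\widetilde P}{L}-\widetilde\sigma^2},\qquad \beta_{n}=\frac{\sigma_{n-1}}{\sigma}\cdot\frac{\sqrt{\mathrm{snr}\,(1-L/\widetilde{\mathrm{snr}})}}{1+\mathrm{snr}},$$ where $$\sigma_n^2=\mathrm{snr}^{-1}\left(1+\mathrm{snr}\cdot\frac{1-L\,\widetilde{\mathrm{snr}}^{-1}}{1+L\,\Delta^{-1}}\right)^{1-n},\qquad \mathrm{snr}_N:=\sigma_N^{-2}.$$ Define $$R^*:=\frac{1}{2N}\log_2\!\left(1+\frac{\mathrm{snr}_N}{\Gamma_0(p_e/2)}\right).$$ Then: (a) If the PAM constellation has $M=2^{NR}$ points with $R\le R^*$, the probability that Terminal B decodes the message incorrectly at time $N$ is at most $p_e$. (b) Let $$\Psi_1=1+L\,\Delta^{-1},\qquad \Psi_2=\frac{1}{1-L\,\widetilde{\mathrm{snr}}^{-1}},\qquad \Psi_3=\frac{10/\ln 10}{\mathrm{snr}\cdot\Psi_1^{-\frac{N-1}{N}}\,\Psi_2^{-\frac{N-1}{N}}\,\Gamma_0(p_e/2)^{-\frac1N}-1},$$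 and assume the denominator of $\Psi_3$ is positive. Then the capacity gap $\Gamma^*:=\mathrm{snr}/(2^{2R^*}-1)$ satisfies $$\Gamma^*_{\mathrm{dB}}<\tfrac1N\,\Gamma_{0,\mathrm{dB}}(p_e/2)+\tfrac{N-1}{N}\left(\Psi_{1,\mathrm{dB}}+\Psi_{2,\mathrm{dB}}\right)+\Psi_3 .$$
   Context: Notation. $Q(x)=\frac{1}{\sqrt{2\pi}}\int_x^\infty e^{-u^2/2}\,du$ is the Gaussian tail function, and $Q^{-1}$ is its inverse. For $x>0$, $x_{\mathrm{dB}}=10\log_{10}x$. $\Gamma_0(p):=\tfrac13[Q^{-1}(p/2)]^2$ is the capacity gap of uncoded PAM. The capacity gap of a scheme at rate $R$ (bits per channel use) is $\Gamma=\mathrm{snr}/(2^{2R}-1)$. Channels. Terminal A (which holds a message $W$ uniform on $M$ values) and Terminal B are connected by a feedforward channel $Y_n=X_n+Z_n$ with $Z_n$ i.i.d. $\mathcal N(0,\sigma^2)$ and power $P$, and a feedback channel $\widetilde Y_n=\widetilde X_n+\widetilde Z_n$ with $\widetilde Z_n$ i.i.d. $\mathcal N(0,\widetilde\sigma^2)$ and power $\widetilde P$. The two noise processes are mutually independent and independent of $W$. Set $\mathrm{snr}=P/\sigma^2$, $\widetilde{\mathrm{snr}}=\widetilde P/\widetilde\sigma^2$ and $\Delta=\widetilde{\mathrm{snr}}/\mathrm{snr}$. Modulo. For $d>0$, $[x]_d:=x-d\cdot\mathrm{round}(x/d)$ (round to the nearest integer, rounding up at half), so $[x]_d\in[-d/2,d/2)$.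 Take $d=\sqrt{12\widetilde P}$. The terminals share common randomness $V_1,\dots,V_N$, i.i.d. uniform on $[-d/2,d/2)$ and independent of $W$ and of the noises. PAM. $W$ is mapped one-to-one to $\Theta\in\{\pm\eta,\pm3\eta,\dots,\pm(M-1)\eta\}$ with $\eta=\sqrt{3/(M^2-1)}$, so that $\Theta$ has unit mean square. Scalar modulo scheme. - Round 1: Terminal A sends $X_1=\sqrt P\,\Theta$, and Terminal B sets $\hat\Theta_1=Y_1/\sqrt P$. - For $n=1,\dots,N-1$: - Terminal B sends $\widetilde X_n=[\gamma_n\hat\Theta_n+V_n]_d$. - Terminal A computes $\tilde\varepsilon_n=[\widetilde Y_n-\gamma_n\Theta-V_n]_d$ and sends $X_{n+1}=\alpha\tilde\varepsilon_n$. - Terminal B sets $\hat\Theta_{n+1}=\hat\Theta_n-\beta_{n+1}Y_{n+1}$. - Decoding: at time $N$, Terminal B decodes $\Theta$ as the PAM point nearest to $\hat\Theta_N$. Write $\varepsilon_n=\hat\Theta_n-\Theta$. The power computation for Terminal A is exact when no modulo-aliasing occurs. *)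

theory Defs
  imports "HOL-Probability.Probability"
begin

definition Qfun :: "real \<Rightarrow> real" where
  "Qfun x = (LBINT u:{x<..}. exp (-(u^2)/2)) / sqrt (2*pi)"

definition Qinv :: "real \<Rightarrow> real" where
  "Qinv p = (THE x. Qfun x = p)"

definition Gamma0 :: "real \<Rightarrow> real" where
  "Gamma0 p = (Qinv (p/2))^2 / 3"

definition dB :: "real \<Rightarrow> real" where
  "dB x = 10 * log 10 x"

text \<open>Centred modulo; round x = floor (x + 1/2) rounds up at half.\<close>
definition modd :: "real \<Rightarrow> real \<Rightarrow> real" where
  "modd d x = x - d * real_of_int (round (x / d))"

definition pam :: "nat \<Rightarrow> nat \<Rightarrow> real" where
  "pam M k = (2 * real k - real M + 1) * sqrt (3 / ((real M)^2 - 1))"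

text \<open>Terminal B's estimate of Theta at time n (n >= 1) in the scalar modulo scheme,
  for message point theta, forward noises z, feedback noises zt, dither v.\<close>
fun thetahat :: "real \<Rightarrow> real \<Rightarrow> real \<Rightarrow> (nat \<Rightarrow> real) \<Rightarrow> (nat \<Rightarrow> real)
    \<Rightarrow> real \<Rightarrow> (nat \<Rightarrow> real) \<Rightarrow> (nat \<Rightarrow> real) \<Rightarrow> (nat \<Rightarrow> real) \<Rightarrow> nat \<Rightarrow> real" where
  "thetahat P d \<alpha> \<gamma> \<beta> \<theta> z zt v 0 = 0"
| "thetahat P d \<alpha> \<gamma> \<beta> \<theta> z zt v (Suc 0) = (sqrt P * \<theta> + z 1) / sqrt P"
| "thetahat P d \<alpha> \<gamma> \<beta> \<theta> z zt v (Suc (Suc n)) =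
    (let h = thetahat P d \<alpha> \<gamma> \<beta> \<theta> z zt v (Suc n);
         xt = modd d (\<gamma> (Suc n) * h + v (Suc n));
         yt = xt + zt (Suc n);
         et = modd d (yt - \<gamma> (Suc n) * \<theta> - v (Suc n));
         x = \<alpha> * et;
         y = x + z (Suc (Suc n))
     in h - \<beta> (Suc (Suc n)) * y)"

text \<open>Decoding error: some other PAM point is at least as close to the estimate
  (ties counted as errors; they have probability zero).\<close>
definition dec_error :: "nat \<Rightarrow> real \<Rightarrow> nat \<Rightarrow> bool" where
  "dec_error M th k = (\<exists>j<M. j \<noteq> k \<and> \<bar>th - pam M j\<bar> \<le> \<bar>th - pam M k\<bar>)"

text \<open>Joint law of (W, Z_1..Z_N, Zt_1..Zt_{N-1}, V_1..V_{N-1}), all independent.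
  sigma, sigmat are noise standard deviations.\<close>
definition scheme_space :: "nat \<Rightarrow> nat \<Rightarrow> real \<Rightarrow> real \<Rightarrow> real
    \<Rightarrow> (nat \<times> (nat \<Rightarrow> real) \<times> (nat \<Rightarrow> real) \<times> (nat \<Rightarrow> real)) measure" where
  "scheme_space M N \<sigma> \<sigma>t d =
     measure_pmf (pmf_of_set {..<M}) \<Otimes>\<^sub>M
      (PiM {1..N} (\<lambda>_. density lborel (normal_density 0 \<sigma>)) \<Otimes>\<^sub>M
       (PiM {1..N-1} (\<lambda>_. density lborel (normal_density 0 \<sigma>t)) \<Otimes>\<^sub>M
        PiM {1..N-1} (\<lambda>_. uniform_measure lborel {-d/2..<d/2})))"

end

theory Submission
  imports Defs
begin

text \<open>Since both terminals know the dither, the inner modulo is absorbed by the outer one and Terminal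
  A observes the feedback error plus feedback noise, reduced modulo d. As long as none of these values
  leaves (-d/2, d/2), the estimation error follows a linear recursion driven by the Gaussian noises,
  so it is centred Gaussian; the parameters are chosen so that its variance at time n is sig n squared
  and the variance entering the modulo is always Pt / L. Hence each of the N - 1 aliasing events has
  probability at most pe / (2N) and a PAM error of the linear system probability at most pe / 2, and
  (a) follows from a union bound on the linear system, to which the actual one is equal outside the
  aliasing events. For (b), dropping the two summands 1 in snrN and in Rs bounds 2 powr (2 Rs) below
  by den + 1, and ln (1 + 1 / den) is at most 1 / den.\<close>

subsection \<open>The Gaussian tail function and centred normal laws\<close>

interpretation std_normal: real_distribution std_normal_distribution
  by (rule real_dist_normal_dist)

text \<open>Recasting the defining integral as a probability gives access to the general facts on
  cdfs of real distributions (continuity, limits).\<close>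

lemma Qfun_eq_measure: "Qfun x = measure std_normal_distribution {x<..}"
proof -
  have "measure std_normal_distribution {x<..} = (LINT u|std_normal_distribution. indicator {x<..} u)"
    by simp
  also have "\<dots> = (LINT u|lborel. std_normal_density u *\<^sub>R indicator {x<..} u)"
    by (subst integral_density) auto
  also have "\<dots> = (LINT u|lborel. (1 / sqrt (2*pi)) * (indicator {x<..} u *\<^sub>R exp (-(u^2)/2)))"
    by (intro Bochner_Integration.integral_cong) (auto simp: std_normal_density_def)
  also have "\<dots> = Qfun x"
    by (simp add: Qfun_def set_lebesgue_integral_def)
  finally show ?thesis ..
qed

lemma Qfun_eq_cdf: "Qfun x = 1 - cdf std_normal_distribution x"
proof -
  have "{x<..} = space std_normal_distribution - {..x}" by auto
  then show ?thesis
    unfolding Qfun_eq_measure cdf_def by (simp only:) (subst std_normal.prob_compl, auto)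
qed

lemma measure_std_normal_singleton: "measure std_normal_distribution {x} = 0"
proof -
  have "emeasure std_normal_distribution {x} = 0"
    by (subst emeasure_density) (auto simp: nn_integral_cmult_indicator)
  then show ?thesis by (simp add: measure_def)
qed

lemma continuous_on_Qfun: "continuous_on UNIV Qfun"
proof -
  have "continuous_on UNIV (cdf std_normal_distribution)"
    using std_normal.isCont_cdf measure_std_normal_singleton
    by (auto intro!: continuous_at_imp_continuous_on)
  then have "continuous_on UNIV (\<lambda>x. 1 - cdf std_normal_distribution x)"
    by (intro continuous_intros)
  then show ?thesis by (simp add: Qfun_eq_cdf[abs_def])
qed

text \<open>The two tails differ by the mass of \<open>{x<..y}\<close>. The density is positive
  everywhere, so zero mass would make this interval a Lebesgue null set. Strictness is what makes
  the \<open>THE\<close> in \<open>Qinv\<close> unique.\<close>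

lemma Qfun_strict_antimono:
  assumes "x < y"
  shows "Qfun y < Qfun x"
proof -
  have "measure std_normal_distribution {x<..} = measure std_normal_distribution ({x<..y} \<union> {y<..})"
    using assms by (intro arg_cong[where f="measure std_normal_distribution"]) auto
  also have "\<dots> = measure std_normal_distribution {x<..y} + measure std_normal_distribution {y<..}"
    by (intro std_normal.finite_measure_Union) auto
  finally have eq: "Qfun x = measure std_normal_distribution {x<..y} + Qfun y"
    by (simp add: Qfun_eq_measure)
  have "measure std_normal_distribution {x<..y} \<noteq> 0"
  proof
    assume "measure std_normal_distribution {x<..y} = 0"
    then have "emeasure std_normal_distribution {x<..y} = 0"
      by (simp add: std_normal.emeasure_eq_measure)
    then have "(\<integral>\<^sup>+u. ennreal (std_normal_density u) * indicator {x<..y} u \<partial>lborel) = 0"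
      by (subst (asm) emeasure_density) auto
    then have "AE u in lborel. ennreal (std_normal_density u) * indicator {x<..y} u = 0"
      by (subst (asm) nn_integral_0_iff_AE) auto
    then have "AE u in lborel. u \<notin> {x<..y}"
    proof eventually_elim
      case (elim u)
      moreover have "std_normal_density u > 0" by (rule normal_density_pos) simp
      ultimately show ?case by (auto simp: indicator_def split: if_splits)
    qed
    then have "emeasure lborel {x<..y} = 0"
      by (subst (asm) AE_iff_measurable[of "{x<..y}"]) auto
    with assms show False by simp
  qed
  then show ?thesis using eq by (simp add: zero_less_measure_iff order_less_le)
qed

lemma Qfun_antimono: "x \<le> y \<Longrightarrow> Qfun y \<le> Qfun x"
  using Qfun_strict_antimono[of x y] by (cases "x = y") auto

text \<open>The affine rule for normal laws with factor -1. It equates lower and upper tails and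
  makes the sign of \<open>s\<close> in \<open>gauss s\<close> irrelevant.\<close>

lemma std_normal_uminus: "distr std_normal_distribution borel uminus = std_normal_distribution"
proof -
  have "distributed std_normal_distribution lborel (\<lambda>x. x) std_normal_density"
    by (simp add: distributed_def distr_id2)
  then have "distributed std_normal_distribution lborel (\<lambda>x. 0 + (-1) * x)
      (normal_density (0 + (-1) * 0) (\<bar>-1\<bar> * 1))"
    by (rule std_normal.normal_density_affine) auto
  then have "distr std_normal_distribution lborel uminus = std_normal_distribution"
    by (simp add: distributed_def)
  then show ?thesis
    by (simp cong: distr_cong)
qed

lemma measure_std_normal_atLeast: "measure std_normal_distribution {x..} = Qfun x"
proof -
  have "{x..} = {x} \<union> {x<..}" by auto
  then have "measure std_normal_distribution {x..} =
      measure std_normal_distribution {x} + measure std_normal_distribution {x<..}"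
    by (simp only:) (rule std_normal.finite_measure_Union, auto)
  then show ?thesis by (simp add: measure_std_normal_singleton Qfun_eq_measure)
qed

lemma measure_std_normal_atMost: "measure std_normal_distribution {..-x} = Qfun x"
proof -
  have "Qfun x = measure (distr std_normal_distribution borel uminus) {x..}"
    by (simp add: measure_std_normal_atLeast std_normal_uminus)
  also have "\<dots> = measure std_normal_distribution (uminus -` {x..})"
    by (subst measure_distr) auto
  also have "uminus -` {x..} = {..-x}" by auto
  finally show ?thesis ..
qed

lemma Qfun_0: "Qfun 0 = 1 / 2"
  using measure_std_normal_atMost[of 0] Qfun_eq_cdf[of 0] by (simp add: cdf_def)

text \<open>\<open>Qfun\<close> falls continuously from 1/2 at 0 to below p at some b, so the
  intermediate value theorem gives a preimage, unique by strict monotonicity. Positivity later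
  allows \<open>Qinv\<close> to be recovered from the squares in \<open>L\<close> and
  \<open>Gamma0\<close>.\<close>

lemma
  assumes "0 < p" "p < 1 / 2"
  shows Qfun_Qinv: "Qfun (Qinv p) = p" and Qinv_pos: "0 < Qinv p"
proof -
  have "(Qfun \<longlongrightarrow> 1 - 1) at_top"
    unfolding Qfun_eq_cdf[abs_def] by (intro tendsto_intros std_normal.cdf_lim_at_top_prob)
  then have "eventually (\<lambda>x. Qfun x < p) at_top"
    using assms by (intro order_tendstoD) auto
  then obtain b where b: "b > 0" "Qfun b < p"
    by (metis (mono_tags, lifting) eventually_at_top_linorder eventually_at_top_dense
        gt_ex less_le_trans linorder_le_cases order_le_less_trans)
  have "\<exists>x\<ge>0. x \<le> b \<and> Qfun x = p"
    using b assms Qfun_0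
    by (intro IVT2') (auto intro: continuous_on_subset[OF continuous_on_Qfun])
  then obtain x where x: "0 \<le> x" "Qfun x = p" by blast
  have "Qinv p = x"
    unfolding Qinv_def
    by (rule the_equality) (use x Qfun_strict_antimono in \<open>auto simp: neq_iff\<close>, metis less_irrefl linorder_neqE)
  moreover have "x \<noteq> 0" using x assms Qfun_0 by auto
  ultimately show "Qfun (Qinv p) = p" "0 < Qinv p" using x by auto
qed

text \<open>The normal law with mean 0 and standard deviation |s|. As an image measure rather than a density
  it also covers the degenerate law s = 0, so sums over possibly vanishing coefficients need no case
  distinction.\<close>

definition gauss :: "real \<Rightarrow> real measure" where
  "gauss s = distr std_normal_distribution borel (\<lambda>x. s * x)"

lemma sets_gauss [simp, measurable_cong]: "sets (gauss s) = sets borel"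
  by (simp add: gauss_def)

lemma space_gauss [simp]: "space (gauss s) = UNIV"
  by (simp add: gauss_def)

lemma prob_space_gauss: "prob_space (gauss s)"
  unfolding gauss_def by (intro std_normal.prob_space_distr) auto

lemma distr_gauss_scale: "distr (gauss s) borel (\<lambda>x. c * x) = gauss (c * s)"
  unfolding gauss_def by (subst distr_distr) (auto simp: comp_def mult.assoc[symmetric])

lemma gauss_uminus: "gauss (- s) = gauss s"
proof -
  have "gauss (- s) = distr (distr std_normal_distribution borel uminus) borel (\<lambda>x. s * x)"
    unfolding gauss_def by (subst distr_distr) (auto simp: comp_def intro!: distr_cong)
  then show ?thesis by (simp add: std_normal_uminus gauss_def)
qed

lemma gauss_abs: "gauss \<bar>s\<bar> = gauss s"
  by (auto simp: abs_if gauss_uminus)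

lemma gauss_0: "gauss 0 = return borel 0"
  unfolding gauss_def using std_normal.distr_const[of 0 borel] by (simp cong: distr_cong)

lemma gauss_eq_density:
  assumes "s > 0"
  shows "gauss s = density lborel (normal_density 0 s)"
proof -
  have "distributed std_normal_distribution lborel (\<lambda>x. x) std_normal_density"
    by (simp add: distributed_def distr_id2)
  then have "distributed std_normal_distribution lborel (\<lambda>x. 0 + s * x)
      (normal_density (0 + s * 0) (\<bar>s\<bar> * 1))"
    using assms by (intro std_normal.normal_density_affine) auto
  then have "distr std_normal_distribution lborel (\<lambda>x. s * x) = density lborel (normal_density 0 s)"
    using assms by (simp add: distributed_def)
  then show ?thesis
    by (simp add: gauss_def cong: distr_cong)
qed

section \<open>Convolutions and linear forms of centred normal variables\<close>

lemma convolution_gauss_0: "gauss s \<star> gauss 0 = gauss s"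
proof (rule measure_eqI)
  interpret prob_space "gauss s" by (rule prob_space_gauss)
  interpret g0: prob_space "gauss 0" by (rule prob_space_gauss)
  fix A assume "A \<in> sets (gauss s \<star> gauss 0)"
  then have [measurable]: "A \<in> sets borel" by simp
  have "emeasure (gauss s \<star> gauss 0) A = (\<integral>\<^sup>+x. \<integral>\<^sup>+y. indicator A (x + y) \<partial>gauss 0 \<partial>gauss s)"
    by (rule convolution_emeasure') (auto intro: finite_measure_axioms g0.finite_measure_axioms)
  also have "\<dots> = (\<integral>\<^sup>+x. indicator A x \<partial>gauss s)"
    by (simp add: gauss_0 nn_integral_return)
  finally show "emeasure (gauss s \<star> gauss 0) A = emeasure (gauss s) A" by simp
qed simp

text \<open>The density formula for convolutions covers nonzero \<open>s\<close> and
  \<open>t\<close>, with absolute values as standard deviations; a zero parameter is a point mass at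
  0, neutral for convolution.\<close>

lemma convolution_gauss: "gauss s \<star> gauss t = gauss (sqrt (s\<^sup>2 + t\<^sup>2))"
proof -
  have fin: "finite_measure (gauss r)" for r
    using prob_space_gauss[of r] by (simp add: prob_space_def)
  consider "t = 0" | "s = 0" | "s \<noteq> 0" "t \<noteq> 0" by blast
  then show ?thesis
  proof cases
    case 1
    then show ?thesis by (simp add: convolution_gauss_0 gauss_abs)
  next
    case 2
    then show ?thesis
      using convolution_commutative[OF fin[of s] fin[of t]]
      by (simp add: convolution_gauss_0 gauss_abs)
  next
    case 3
    have "gauss \<bar>s\<bar> \<star> gauss \<bar>t\<bar> = gauss (sqrt (\<bar>s\<bar>\<^sup>2 + \<bar>t\<bar>\<^sup>2))"
      using 3 fin[of "\<bar>s\<bar>"] fin[of "\<bar>t\<bar>"]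
      by (simp add: gauss_eq_density convolution_density sum_power2_gt_zero_iff
          ennreal_mult'[symmetric] conv_normal_density_zero_mean del: power2_abs)
    then show ?thesis by (simp add: gauss_abs)
  qed
qed

lemma measure_gauss_tail_le:
  assumes "s > 0"
  shows "measure (gauss s) {x. \<tau> \<le> \<bar>x\<bar>} \<le> 2 * Qfun (\<tau> / s)"
proof -
  have "measure (gauss s) {x. \<tau> \<le> \<bar>x\<bar>} = measure std_normal_distribution {x. \<tau> \<le> \<bar>s * x\<bar>}"
    unfolding gauss_def by (subst measure_distr) auto
  also have "{x. \<tau> \<le> \<bar>s * x\<bar>} \<subseteq> {\<tau> / s..} \<union> {..- (\<tau> / s)}"
    using assms by (auto simp: field_simps abs_if split: if_splits)
  then have "measure std_normal_distribution {x. \<tau> \<le> \<bar>s * x\<bar>}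
      \<le> measure std_normal_distribution ({\<tau> / s..} \<union> {..- (\<tau> / s)})"
    by (intro std_normal.finite_measure_mono) auto
  also have "\<dots> \<le> measure std_normal_distribution {\<tau> / s..}
      + measure std_normal_distribution {..- (\<tau> / s)}"
    by (intro measure_Un_le) auto
  also have "\<dots> = 2 * Qfun (\<tau> / s)"
    by (simp add: measure_std_normal_atLeast measure_std_normal_atMost)
  finally show ?thesis .
qed

text \<open>Induction on the index set: splitting off one coordinate turns the sum into a sum of two
  independent variables, whose law is a convolution of two \<open>gauss\<close> laws.\<close>

lemma distr_PiM_gauss_sum:
  assumes "finite I"
  shows "distr (PiM I (\<lambda>_. gauss s)) borel (\<lambda>x. \<Sum>i\<in>I. c i * x i) = gauss (s * sqrt (\<Sum>i\<in>I. (c i)\<^sup>2))"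
  using assms
proof (induction I rule: finite_induct)
  case empty
  interpret prob_space "PiM {} (\<lambda>_::'a. gauss s)"
    by (intro prob_space_PiM prob_space_gauss)
  show ?case by (simp add: distr_const gauss_0)
next
  case (insert i I)
  let ?P = "PiM I (\<lambda>_. gauss s)"
  have [measurable]: "(\<lambda>x. \<Sum>j\<in>I. c j * x j) \<in> borel_measurable ?P"
    by measurable
  interpret P: prob_space ?P
    by (intro prob_space_PiM prob_space_gauss)
  have "distr (PiM (insert i I) (\<lambda>_. gauss s)) borel (\<lambda>x. \<Sum>j\<in>insert i I. c j * x j)
      = distr (distr (gauss s \<Otimes>\<^sub>M ?P) (PiM (insert i I) (\<lambda>_. gauss s)) (\<lambda>(x, X). X(i := x)))
          borel (\<lambda>x. \<Sum>j\<in>insert i I. c j * x j)"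
    by (subst distr_pair_PiM_eq_PiM) (auto intro: prob_space_gauss)
  also have "\<dots> = distr (gauss s \<Otimes>\<^sub>M ?P) borel
      ((\<lambda>x. \<Sum>j\<in>insert i I. c j * x j) \<circ> (\<lambda>(x, X). X(i := x)))"
    by (rule distr_distr) measurable
  \<comment> \<open>Factoring addition through the pair of summands makes the joint law a product,
    which is the form in which convolution is defined.\<close>
  also have "\<dots> = distr (gauss s \<Otimes>\<^sub>M ?P) borel
      ((\<lambda>(x, y). x + y) \<circ> (\<lambda>(x, X). (c i * x, \<Sum>j\<in>I. c j * X j)))"
    using insert.hyps by (intro distr_cong) (auto intro!: sum.cong)
  also have "\<dots> = distr (distr (gauss s \<Otimes>\<^sub>M ?P) (borel \<Otimes>\<^sub>M borel)
      (\<lambda>(x, X). (c i * x, \<Sum>j\<in>I. c j * X j))) borel (\<lambda>(x, y). x + y)"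
    by (rule distr_distr[symmetric]) measurable
  also have "distr (gauss s \<Otimes>\<^sub>M ?P) (borel \<Otimes>\<^sub>M borel) (\<lambda>(x, X). (c i * x, \<Sum>j\<in>I. c j * X j))
      = distr (gauss s) borel (\<lambda>x. c i * x) \<Otimes>\<^sub>M distr ?P borel (\<lambda>X. \<Sum>j\<in>I. c j * X j)"
    by (rule pair_measure_distr[symmetric])
       (auto intro!: prob_space_imp_sigma_finite P.prob_space_distr)
  also have "\<dots> = gauss (c i * s) \<Otimes>\<^sub>M gauss (s * sqrt (\<Sum>j\<in>I. (c j)\<^sup>2))"
    by (simp only: distr_gauss_scale insert.IH)
  also have "distr \<dots> borel (\<lambda>(x, y). x + y)
      = gauss (sqrt ((c i * s)\<^sup>2 + (s * sqrt (\<Sum>j\<in>I. (c j)\<^sup>2))\<^sup>2))"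
    by (simp add: convolution_gauss flip: convolution_def)
  also have "(c i * s)\<^sup>2 + (s * sqrt (\<Sum>j\<in>I. (c j)\<^sup>2))\<^sup>2 = s\<^sup>2 * (\<Sum>j\<in>insert i I. (c j)\<^sup>2)"
    using insert.hyps by (simp add: power_mult_distrib sum_nonneg algebra_simps)
  \<comment> \<open>Only the absolute value comes out of the root, since \<open>s\<close> may be
    negative; \<open>gauss_abs\<close> removes it.\<close>
  also have "sqrt \<dots> = \<bar>s * sqrt (\<Sum>j\<in>insert i I. (c j)\<^sup>2)\<bar>"
    by (simp add: real_sqrt_mult abs_mult sum_nonneg del: sum.insert)
  finally show ?case by (simp only: gauss_abs)
qed

text \<open>Forward and feedback noises have different standard deviations, so each family is summed
  separately and the two sums are convolved.\<close>

lemma distr_gauss_linear: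
  assumes "finite I" "finite J"
  shows "distr (PiM I (\<lambda>_. gauss s) \<Otimes>\<^sub>M PiM J (\<lambda>_. gauss t)) borel
      (\<lambda>(x, y). (\<Sum>i\<in>I. a i * x i) + (\<Sum>j\<in>J. b j * y j))
    = gauss (sqrt (s\<^sup>2 * (\<Sum>i\<in>I. (a i)\<^sup>2) + t\<^sup>2 * (\<Sum>j\<in>J. (b j)\<^sup>2)))" (is "distr (?P \<Otimes>\<^sub>M ?Q) _ _ = _")
proof -
  interpret Q: prob_space ?Q
    by (intro prob_space_PiM prob_space_gauss)
  have "distr (?P \<Otimes>\<^sub>M ?Q) borel (\<lambda>(x, y). (\<Sum>i\<in>I. a i * x i) + (\<Sum>j\<in>J. b j * y j))
    = distr (?P \<Otimes>\<^sub>M ?Q) borel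
      ((\<lambda>(x, y). x + y) \<circ> (\<lambda>(x, y). (\<Sum>i\<in>I. a i * x i, \<Sum>j\<in>J. b j * y j)))"
    by (intro distr_cong) auto
  also have "\<dots> = distr (distr (?P \<Otimes>\<^sub>M ?Q) (borel \<Otimes>\<^sub>M borel)
      (\<lambda>(x, y). (\<Sum>i\<in>I. a i * x i, \<Sum>j\<in>J. b j * y j))) borel (\<lambda>(x, y). x + y)"
    by (rule distr_distr[symmetric]) measurable
  also have "distr (?P \<Otimes>\<^sub>M ?Q) (borel \<Otimes>\<^sub>M borel)
        (\<lambda>(x, y). (\<Sum>i\<in>I. a i * x i, \<Sum>j\<in>J. b j * y j))
      = distr ?P borel (\<lambda>x. \<Sum>i\<in>I. a i * x i) \<Otimes>\<^sub>M distr ?Q borel (\<lambda>y. \<Sum>j\<in>J. b j * y j)"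
    by (rule pair_measure_distr[symmetric])
       (auto intro!: prob_space_imp_sigma_finite Q.prob_space_distr)
  also have "distr \<dots> borel (\<lambda>(x, y). x + y)
      = gauss (sqrt ((s * sqrt (\<Sum>i\<in>I. (a i)\<^sup>2))\<^sup>2 + (t * sqrt (\<Sum>j\<in>J. (b j)\<^sup>2))\<^sup>2))"
    using assms by (simp add: distr_PiM_gauss_sum convolution_gauss flip: convolution_def)
  also have "\<dots> = gauss (sqrt (s\<^sup>2 * (\<Sum>i\<in>I. (a i)\<^sup>2) + t\<^sup>2 * (\<Sum>j\<in>J. (b j)\<^sup>2)))"
    by (simp add: power_mult_distrib sum_nonneg)
  finally show ?thesis .
qed

subsection \<open>The scheme without modulo operations\<close>

lemma modd_add_period:
  assumes "d > 0"
  shows "modd d (x + d * real_of_int k) = modd d x"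
proof -
  have "(x + d * real_of_int k) / d + 1 / 2 = (x / d + 1 / 2) + real_of_int k"
    using assms by (simp add: field_simps)
  then have "round ((x + d * real_of_int k) / d) = round (x / d) + k"
    unfolding round_def by (simp only: floor_add_int)
  then show ?thesis by (simp add: modd_def algebra_simps)
qed

text \<open>Reduction changes x by a multiple of d only, which an outer reduction cannot see.
  Terminal A can therefore subtract message and dither as if Terminal B had not reduced.\<close>

lemma modd_modd_add:
  assumes "d > 0"
  shows "modd d (modd d x + y) = modd d (x + y)"
proof -
  have "modd d x + y = (x + y) + d * real_of_int (- round (x / d))"
    by (simp add: modd_def)
  then show ?thesis using modd_add_period[OF assms] by (simp only:)
qed

lemma modd_eq_self:
  assumes "d > 0" "\<bar>x\<bar> < d / 2"
  shows "modd d x = x"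
proof -
  have "\<lfloor>x / d + 1 / 2\<rfloor> = 0"
    using assms by (intro floor_unique) (auto simp: field_simps abs_less_iff)
  then show ?thesis by (simp add: modd_def round_def)
qed

lemma measurable_modd [measurable]: "modd d \<in> borel_measurable borel"
  unfolding modd_def[abs_def] round_def by measurable

text \<open>The estimation error when no aliasing ever occurs: the scheme with both modulo operations
  removed, which is linear in the noises and involves neither the message nor the dither.\<close>

fun lin_err :: "real \<Rightarrow> real \<Rightarrow> (nat \<Rightarrow> real) \<Rightarrow> (nat \<Rightarrow> real)
    \<Rightarrow> (nat \<Rightarrow> real) \<Rightarrow> (nat \<Rightarrow> real) \<Rightarrow> nat \<Rightarrow> real" where
  "lin_err P \<alpha> \<gamma> \<beta> z zt 0 = 0"
| "lin_err P \<alpha> \<gamma> \<beta> z zt (Suc 0) = z 1 / sqrt P"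
| "lin_err P \<alpha> \<gamma> \<beta> z zt (Suc (Suc n)) =
    (let e = lin_err P \<alpha> \<gamma> \<beta> z zt (Suc n)
     in e - \<beta> (Suc (Suc n)) * (\<alpha> * (\<gamma> (Suc n) * e + zt (Suc n)) + z (Suc (Suc n))))"

section \<open>The linear error recursion and its variance\<close>

lemma lin_err_Suc:
  assumes "n \<ge> 1"
  shows "lin_err P \<alpha> \<gamma> \<beta> z zt (Suc n) = (1 - \<beta> (Suc n) * \<alpha> * \<gamma> n) * lin_err P \<alpha> \<gamma> \<beta> z zt n
    - \<beta> (Suc n) * \<alpha> * zt n - \<beta> (Suc n) * z (Suc n)"
  using assms by (cases n) (auto simp: Let_def algebra_simps)

text \<open>Induction on time: after \<open>modd_modd_add\<close> the message and the dither cancel,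
  and the bound at round n removes the outer reduction. The bounds stop at \<open>i < n\<close>
  because the modulo value of round i first affects the estimate at \<open>Suc i\<close>.\<close>

lemma thetahat_eq_lin_err:
  assumes "P > 0" "d > 0" "n \<ge> 1"
    and "\<And>i. 1 \<le> i \<Longrightarrow> i < n \<Longrightarrow> \<bar>\<gamma> i * lin_err P \<alpha> \<gamma> \<beta> z zt i + zt i\<bar> < d / 2"
  shows "thetahat P d \<alpha> \<gamma> \<beta> \<theta> z zt v n = \<theta> + lin_err P \<alpha> \<gamma> \<beta> z zt n"
  using assms(3,4)
proof (induction n rule: dec_induct)
  case base
  then show ?case using assms(1) by (simp add: field_simps)
next
  case (step n)
  then obtain m where n: "n = Suc m" by (cases n) auto
  let ?e = "lin_err P \<alpha> \<gamma> \<beta> z zt n"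
  have IH: "thetahat P d \<alpha> \<gamma> \<beta> \<theta> z zt v n = \<theta> + ?e"
    using step by auto
  have "modd d (modd d (\<gamma> n * (\<theta> + ?e) + v n) + zt n - \<gamma> n * \<theta> - v n)
      = modd d (modd d (\<gamma> n * (\<theta> + ?e) + v n) + (zt n - \<gamma> n * \<theta> - v n))"
    by (simp add: algebra_simps)
  also have "\<dots> = modd d (\<gamma> n * ?e + zt n)"
    unfolding modd_modd_add[OF assms(2)] by (simp add: algebra_simps)
  also have "\<dots> = \<gamma> n * ?e + zt n"
    using step.prems[of n] step.hyps assms(2) by (intro modd_eq_self) auto
  finally show ?case
    using IH unfolding n by (simp add: Let_def)
qed

text \<open>Unrolling the recursion gives explicit coefficients on the noises. Their vanishing at
  later indices is carried along so that each step adds fresh noise and the squares add up. The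
  range for \<open>b\<close> starts at n itself, since \<open>zt n\<close> enters only at
  \<open>Suc n\<close>. \<open>V\<close> is any sequence obeying the variance recursion; the
  concrete parameters come in later.\<close>

lemma lin_err_coefficients:
  fixes V :: "nat \<Rightarrow> real"
  assumes "1 \<le> n" "n \<le> N" "P > 0"
    and V1: "V 1 = \<sigma>\<^sup>2 / P"
    and V_Suc: "\<And>m. 1 \<le> m \<Longrightarrow> V (Suc m) =
        (1 - \<beta> (Suc m) * \<alpha> * \<gamma> m)\<^sup>2 * V m + (\<beta> (Suc m))\<^sup>2 * (\<alpha>\<^sup>2 * \<sigma>t\<^sup>2 + \<sigma>\<^sup>2)"
  obtains a b where
    "\<And>z zt. lin_err P \<alpha> \<gamma> \<beta> z zt n = (\<Sum>i\<in>{1..N}. a i * z i) + (\<Sum>i\<in>{1..N-1}. b i * zt i)"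
    "\<And>i. n < i \<Longrightarrow> a i = 0" "\<And>i. n \<le> i \<Longrightarrow> b i = 0"
    "\<sigma>\<^sup>2 * (\<Sum>i\<in>{1..N}. (a i)\<^sup>2) + \<sigma>t\<^sup>2 * (\<Sum>i\<in>{1..N-1}. (b i)\<^sup>2) = V n"
  using assms(1,2)
proof (induction n arbitrary: thesis rule: dec_induct)
  case base
  let ?a = "\<lambda>i::nat. if i = 1 then 1 / sqrt P else 0" and ?b = "\<lambda>i::nat. 0 :: real"
  show ?case
  proof (rule base(1)[of ?a ?b])
    show "lin_err P \<alpha> \<gamma> \<beta> z zt 1 = (\<Sum>i\<in>{1..N}. ?a i * z i) + (\<Sum>i\<in>{1..N-1}. ?b i * zt i)" for z zt
      using base(2) by (simp add: if_distrib[where f="\<lambda>x. x * _"] sum.delta cong: if_cong)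
    show "\<sigma>\<^sup>2 * (\<Sum>i\<in>{1..N}. (?a i)\<^sup>2) + \<sigma>t\<^sup>2 * (\<Sum>i\<in>{1..N-1}. (?b i)\<^sup>2) = V 1"
      using base(2) \<open>P > 0\<close>
      by (simp add: V1[simplified] if_distrib[where f="\<lambda>x. x\<^sup>2"] sum.delta power_divide cong: if_cong)
  qed auto
next
  case (step n)
  define c where "c = 1 - \<beta> (Suc n) * \<alpha> * \<gamma> n"
  have N: "Suc n \<in> {1..N}" "n \<in> {1..N-1}" using step.hyps step.prems by auto
  obtain a b where
    lin: "\<And>z zt. lin_err P \<alpha> \<gamma> \<beta> z zt n = (\<Sum>i\<in>{1..N}. a i * z i) + (\<Sum>i\<in>{1..N-1}. b i * zt i)"
    and a0: "\<And>i. n < i \<Longrightarrow> a i = 0" and b0: "\<And>i. n \<le> i \<Longrightarrow> b i = 0"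
    and var: "\<sigma>\<^sup>2 * (\<Sum>i\<in>{1..N}. (a i)\<^sup>2) + \<sigma>t\<^sup>2 * (\<Sum>i\<in>{1..N-1}. (b i)\<^sup>2) = V n"
    by (rule step.IH[OF _ Suc_leD[OF step.prems(2)]]) (rule that)
  define a' where "a' i = c * a i + (if i = Suc n then - \<beta> (Suc n) else 0)" for i
  define b' where "b' i = c * b i + (if i = n then - \<beta> (Suc n) * \<alpha> else 0)" for i
  show ?case
  proof (rule step.prems(1)[of a' b'])
    fix z zt
    have "(\<Sum>i\<in>{1..N}. a' i * z i) = (\<Sum>i\<in>{1..N}. c * (a i * z i) + (if i = Suc n then - \<beta> (Suc n) * z i else 0))"
      by (intro sum.cong) (auto simp: a'_def algebra_simps)
    also have "\<dots> = c * (\<Sum>i\<in>{1..N}. a i * z i) - \<beta> (Suc n) * z (Suc n)"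
      using N by (simp add: sum.distrib sum_distrib_left)
    finally have A: "(\<Sum>i\<in>{1..N}. a' i * z i) = \<dots>" .
    have "(\<Sum>i\<in>{1..N-1}. b' i * zt i)
        = (\<Sum>i\<in>{1..N-1}. c * (b i * zt i) + (if i = n then - \<beta> (Suc n) * \<alpha> * zt i else 0))"
      by (intro sum.cong) (auto simp: b'_def algebra_simps)
    also have "\<dots> = c * (\<Sum>i\<in>{1..N-1}. b i * zt i) - \<beta> (Suc n) * \<alpha> * zt n"
      using N by (simp add: sum.distrib sum_distrib_left)
    finally have B: "(\<Sum>i\<in>{1..N-1}. b' i * zt i) = \<dots>" .
    show "lin_err P \<alpha> \<gamma> \<beta> z zt (Suc n) = (\<Sum>i\<in>{1..N}. a' i * z i) + (\<Sum>i\<in>{1..N-1}. b' i * zt i)"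
      unfolding A B lin_err_Suc[OF step.hyps(1)] lin c_def by (simp add: algebra_simps)
  next
    \<comment> \<open>No cross term arises, because \<open>a (Suc n) = 0\<close>; likewise
      \<open>b n = 0\<close> below.\<close>
    have "(\<Sum>i\<in>{1..N}. (a' i)\<^sup>2) = (\<Sum>i\<in>{1..N}. c\<^sup>2 * (a i)\<^sup>2 + (if i = Suc n then (\<beta> (Suc n))\<^sup>2 else 0))"
      by (intro sum.cong) (auto simp: a'_def a0 power_mult_distrib)
    also have "\<dots> = c\<^sup>2 * (\<Sum>i\<in>{1..N}. (a i)\<^sup>2) + (\<beta> (Suc n))\<^sup>2"
      using N by (simp add: sum.distrib sum_distrib_left)
    finally have A: "(\<Sum>i\<in>{1..N}. (a' i)\<^sup>2) = \<dots>" .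
    have "(\<Sum>i\<in>{1..N-1}. (b' i)\<^sup>2)
        = (\<Sum>i\<in>{1..N-1}. c\<^sup>2 * (b i)\<^sup>2 + (if i = n then (\<beta> (Suc n))\<^sup>2 * \<alpha>\<^sup>2 else 0))"
      by (intro sum.cong) (auto simp: b'_def b0 power_mult_distrib)
    also have "\<dots> = c\<^sup>2 * (\<Sum>i\<in>{1..N-1}. (b i)\<^sup>2) + (\<beta> (Suc n))\<^sup>2 * \<alpha>\<^sup>2"
      using N by (simp add: sum.distrib sum_distrib_left)
    finally have B: "(\<Sum>i\<in>{1..N-1}. (b' i)\<^sup>2) = \<dots>" .
    show "\<sigma>\<^sup>2 * (\<Sum>i\<in>{1..N}. (a' i)\<^sup>2) + \<sigma>t\<^sup>2 * (\<Sum>i\<in>{1..N-1}. (b' i)\<^sup>2) = V (Suc n)"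
      unfolding A B V_Suc[OF step.hyps(1)] var[symmetric] c_def[symmetric]
      by (simp add: algebra_simps)
  qed (auto simp: a'_def b'_def a0 b0)
qed

text \<open>This is the quantity Terminal A sees before its reduction, up to multiples of d. The
  error at time n does not contain \<open>zt n\<close>, so its variance is simply increased by that
  of the new noise.\<close>

lemma aliasing_coefficients:
  fixes V :: "nat \<Rightarrow> real"
  assumes "1 \<le> n" "n < N" "P > 0"
    and V1: "V 1 = \<sigma>\<^sup>2 / P"
    and V_Suc: "\<And>m. 1 \<le> m \<Longrightarrow> V (Suc m) =
        (1 - \<beta> (Suc m) * \<alpha> * \<gamma> m)\<^sup>2 * V m + (\<beta> (Suc m))\<^sup>2 * (\<alpha>\<^sup>2 * \<sigma>t\<^sup>2 + \<sigma>\<^sup>2)"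
  obtains a b where
    "\<And>z zt. \<gamma> n * lin_err P \<alpha> \<gamma> \<beta> z zt n + zt n
      = (\<Sum>i\<in>{1..N}. a i * z i) + (\<Sum>i\<in>{1..N-1}. b i * zt i)"
    "\<sigma>\<^sup>2 * (\<Sum>i\<in>{1..N}. (a i)\<^sup>2) + \<sigma>t\<^sup>2 * (\<Sum>i\<in>{1..N-1}. (b i)\<^sup>2) = (\<gamma> n)\<^sup>2 * V n + \<sigma>t\<^sup>2"
proof -
  obtain a b where
    lin: "\<And>z zt. lin_err P \<alpha> \<gamma> \<beta> z zt n = (\<Sum>i\<in>{1..N}. a i * z i) + (\<Sum>i\<in>{1..N-1}. b i * zt i)"
    and b0: "\<And>i. n \<le> i \<Longrightarrow> b i = 0"
    and var: "\<sigma>\<^sup>2 * (\<Sum>i\<in>{1..N}. (a i)\<^sup>2) + \<sigma>t\<^sup>2 * (\<Sum>i\<in>{1..N-1}. (b i)\<^sup>2) = V n"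
    by (rule lin_err_coefficients[where V = V, OF assms(1) less_imp_le[OF assms(2)] assms(3-5)])
      (assumption, rule that)
  have N: "n \<in> {1..N-1}" using assms by auto
  define b' where "b' i = \<gamma> n * b i + (if i = n then 1 else 0)" for i
  show ?thesis
  proof (rule that[of "\<lambda>i. \<gamma> n * a i" b'])
    fix z zt
    have "(\<Sum>i\<in>{1..N-1}. b' i * zt i)
        = (\<Sum>i\<in>{1..N-1}. \<gamma> n * (b i * zt i) + (if i = n then zt i else 0))"
      by (intro sum.cong) (auto simp: b'_def algebra_simps)
    also have "\<dots> = \<gamma> n * (\<Sum>i\<in>{1..N-1}. b i * zt i) + zt n"
      using N by (simp add: sum.distrib sum_distrib_left)
    finally show "\<gamma> n * lin_err P \<alpha> \<gamma> \<beta> z zt n + zt n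
        = (\<Sum>i\<in>{1..N}. \<gamma> n * a i * z i) + (\<Sum>i\<in>{1..N-1}. b' i * zt i)"
      by (simp add: lin algebra_simps sum_distrib_left)
  next
    have "(\<Sum>i\<in>{1..N-1}. (b' i)\<^sup>2)
        = (\<Sum>i\<in>{1..N-1}. (\<gamma> n)\<^sup>2 * (b i)\<^sup>2 + (if i = n then 1 else 0))"
      by (intro sum.cong) (auto simp: b'_def b0 power_mult_distrib)
    also have "\<dots> = (\<gamma> n)\<^sup>2 * (\<Sum>i\<in>{1..N-1}. (b i)\<^sup>2) + 1"
      using N by (simp add: sum.distrib sum_distrib_left)
    finally have B: "(\<Sum>i\<in>{1..N-1}. (b' i)\<^sup>2) = \<dots>" .
    show "\<sigma>\<^sup>2 * (\<Sum>i\<in>{1..N}. (\<gamma> n * a i)\<^sup>2) + \<sigma>t\<^sup>2 * (\<Sum>i\<in>{1..N-1}. (b' i)\<^sup>2) = (\<gamma> n)\<^sup>2 * V n + \<sigma>t\<^sup>2"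
      unfolding B var[symmetric]
      by (simp add: power_mult_distrib algebra_simps flip: sum_distrib_left)
  qed
qed

subsection \<open>The joint law of the noises\<close>

text \<open>Serves to discard the message coordinate of the joint law.\<close>

lemma (in prob_space) distr_pair_snd:
  assumes "sigma_finite_measure N"
  shows "distr (M \<Otimes>\<^sub>M N) N snd = N"
proof (rule measure_eqI)
  interpret N: sigma_finite_measure N by fact
  fix A assume A: "A \<in> sets (distr (M \<Otimes>\<^sub>M N) N snd)"
  then have "emeasure (distr (M \<Otimes>\<^sub>M N) N snd) A = emeasure (M \<Otimes>\<^sub>M N) (space M \<times> A)"
    by (auto simp add: emeasure_distr space_pair_measure dest: sets.sets_into_space
        intro!: arg_cong2[where f=emeasure])
  with A show "emeasure (distr (M \<Otimes>\<^sub>M N) N snd) A = emeasure N A"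
    by (simp add: N.emeasure_pair_measure_Times emeasure_space_1)
qed simp

lemma prob_space_pair:
  assumes "prob_space M" "prob_space N"
  shows "prob_space (M \<Otimes>\<^sub>M N)"
proof -
  interpret pair_prob_space M N
    using assms by (simp add: pair_prob_space_def pair_sigma_finite_def prob_space_imp_sigma_finite)
  show ?thesis by (rule prob_space_axioms)
qed

lemma prob_space_dither:
  fixes d :: real
  assumes "d > 0"
  shows "prob_space (PiM I (\<lambda>_. uniform_measure lborel {-d/2..<d/2}))"
  using assms by (intro prob_space_PiM prob_space_uniform_measure) auto

lemma scheme_space_gauss:
  assumes "\<sigma> > 0" "\<sigma>t > 0"
  shows "scheme_space M N \<sigma> \<sigma>t d = measure_pmf (pmf_of_set {..<M}) \<Otimes>\<^sub>M
      (PiM {1..N} (\<lambda>_. gauss \<sigma>) \<Otimes>\<^sub>M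
       (PiM {1..N-1} (\<lambda>_. gauss \<sigma>t) \<Otimes>\<^sub>M
        PiM {1..N-1} (\<lambda>_. uniform_measure lborel {-d/2..<d/2})))"
  using assms by (simp add: scheme_space_def gauss_eq_density)

lemma prob_space_scheme_space:
  assumes "\<sigma> > 0" "\<sigma>t > 0" "d > 0"
  shows "prob_space (scheme_space M N \<sigma> \<sigma>t d)"
  unfolding scheme_space_gauss[OF assms(1,2)]
  by (intro prob_space_pair prob_space_PiM prob_space_gauss prob_space_dither assms
      prob_space_measure_pmf)

text \<open>The linear error depends on the noises alone, so message and dither are marginalised
  out: first the leftmost factor by \<open>snd\<close>, then the rightmost by
  \<open>fst\<close>.\<close>

lemma distr_scheme_space_noises:
  assumes "\<sigma> > 0" "\<sigma>t > 0" "d > 0"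
  shows "distr (scheme_space M N \<sigma> \<sigma>t d) (PiM {1..N} (\<lambda>_. gauss \<sigma>) \<Otimes>\<^sub>M PiM {1..N-1} (\<lambda>_. gauss \<sigma>t))
      (\<lambda>(k, z, zt, v). (z, zt)) = PiM {1..N} (\<lambda>_. gauss \<sigma>) \<Otimes>\<^sub>M PiM {1..N-1} (\<lambda>_. gauss \<sigma>t)"
proof -
  let ?K = "measure_pmf (pmf_of_set {..<M})" and ?Z = "PiM {1..N} (\<lambda>_. gauss \<sigma>)"
    and ?T = "PiM {1..N-1} (\<lambda>_. gauss \<sigma>t)"
    and ?V = "PiM {1..N-1} (\<lambda>_::nat. uniform_measure lborel {-d/2..<d/2})"
  have Z: "prob_space ?Z" and T: "prob_space ?T" and V: "prob_space ?V"
    using assms by (intro prob_space_PiM prob_space_gauss prob_space_dither; simp)+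
  have "distr (?K \<Otimes>\<^sub>M (?Z \<Otimes>\<^sub>M (?T \<Otimes>\<^sub>M ?V))) (?Z \<Otimes>\<^sub>M ?T) (\<lambda>(k, z, zt, v). (z, zt))
      = distr (distr (?K \<Otimes>\<^sub>M (?Z \<Otimes>\<^sub>M (?T \<Otimes>\<^sub>M ?V))) (?Z \<Otimes>\<^sub>M (?T \<Otimes>\<^sub>M ?V)) snd)
          (?Z \<Otimes>\<^sub>M ?T) (\<lambda>(z, y). (z, fst y))"
    by (subst distr_distr) (auto intro!: distr_cong)
  also have "\<dots> = distr (?Z \<Otimes>\<^sub>M (?T \<Otimes>\<^sub>M ?V)) (?Z \<Otimes>\<^sub>M ?T) (\<lambda>(z, y). (z, fst y))"
    using Z T V
    by (subst prob_space.distr_pair_snd)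
       (auto intro!: prob_space_measure_pmf prob_space_imp_sigma_finite prob_space_pair)
  also have "\<dots> = distr ?Z ?Z (\<lambda>z. z) \<Otimes>\<^sub>M distr (?T \<Otimes>\<^sub>M ?V) ?T fst"
    using T V
    by (subst pair_measure_distr) (auto simp: prob_space.distr_pair_fst intro!: prob_space_imp_sigma_finite)
  also have "\<dots> = ?Z \<Otimes>\<^sub>M ?T"
    using V by (simp add: prob_space.distr_pair_fst distr_id2)
  finally show ?thesis
    unfolding scheme_space_gauss[OF assms(1,2)] .
qed

lemma measurable_scheme_space [measurable]:
  assumes "\<sigma> > 0" "\<sigma>t > 0"
  shows "(\<lambda>(k, z, zt, v). (z, zt)) \<in> scheme_space M N \<sigma> \<sigma>t d \<rightarrow>\<^sub>M
    PiM {1..N} (\<lambda>_. gauss \<sigma>) \<Otimes>\<^sub>M PiM {1..N-1} (\<lambda>_. gauss \<sigma>t)"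
  unfolding scheme_space_gauss[OF assms] by measurable

text \<open>Pushing the joint law forward along the noises and then along the linear form yields
  \<open>gauss s\<close>. Stated for any linear form, as it serves both the aliasing events and the
  final error.\<close>

lemma scheme_space_linear_tail:
  fixes M :: nat and \<tau> :: real
  assumes "\<sigma> > 0" "\<sigma>t > 0" "d > 0"
    and f: "\<And>z zt. f z zt = (\<Sum>i\<in>{1..N}. a i * z i) + (\<Sum>i\<in>{1..N-1}. b i * zt i)"
    and var: "\<sigma>\<^sup>2 * (\<Sum>i\<in>{1..N}. (a i)\<^sup>2) + \<sigma>t\<^sup>2 * (\<Sum>i\<in>{1..N-1}. (b i)\<^sup>2) = s\<^sup>2" and "s > 0"
  defines "E \<equiv> {\<omega> \<in> space (scheme_space M N \<sigma> \<sigma>t d). case \<omega> of (k, z, zt, v) \<Rightarrow> \<tau> \<le> \<bar>f z zt\<bar>}"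
  shows "E \<in> sets (scheme_space M N \<sigma> \<sigma>t d)"
    and "measure (scheme_space M N \<sigma> \<sigma>t d) E \<le> 2 * Qfun (\<tau> / s)"
proof -
  let ?S = "scheme_space M N \<sigma> \<sigma>t d"
  let ?ZT = "PiM {1..N} (\<lambda>_. gauss \<sigma>) \<Otimes>\<^sub>M PiM {1..N-1} (\<lambda>_. gauss \<sigma>t)"
  let ?h = "\<lambda>(k, z, zt, v). (z, zt)"
  let ?l = "\<lambda>(z, zt). (\<Sum>i\<in>{1..N}. a i * z i) + (\<Sum>i\<in>{1..N-1}. b i * zt i)"
  have h: "?h \<in> ?S \<rightarrow>\<^sub>M ?ZT" using assms by measurable
  have l: "?l \<in> borel_measurable ?ZT" by measurable
  have lh: "?l \<circ> ?h \<in> borel_measurable ?S" by (rule measurable_comp[OF h l])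
  have E: "E = (?l \<circ> ?h) -` {x. \<tau> \<le> \<bar>x\<bar>} \<inter> space ?S"
    by (auto simp: E_def f)
  show "E \<in> sets ?S"
    unfolding E by (rule measurable_sets[OF lh]) measurable
  have "distr ?S borel (?l \<circ> ?h) = distr (distr ?S ?ZT ?h) borel ?l"
    by (rule distr_distr[OF l h, symmetric])
  also have "\<dots> = gauss s"
    unfolding distr_scheme_space_noises[OF assms(1-3)]
    using \<open>s > 0\<close> by (subst distr_gauss_linear) (auto simp: var[simplified])
  finally have "measure ?S E = measure (gauss s) {x. \<tau> \<le> \<bar>x\<bar>}"
    unfolding E by (subst measure_distr[OF lh, symmetric]) auto
  then show "measure ?S E \<le> 2 * Qfun (\<tau> / s)"
    using measure_gauss_tail_le[OF \<open>s > 0\<close>] by simp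
qed

text \<open>The estimate at time n uses n forward noises but only n - 1 feedback noises and dithers.
  At \<open>n = N\<close> these are exactly the index sets of \<open>scheme_space\<close>.\<close>

lemma borel_measurable_thetahat:
  assumes th: "th \<in> borel_measurable A"
    and "\<And>i. 1 \<le> i \<Longrightarrow> i \<le> n \<Longrightarrow> (\<lambda>\<omega>. z \<omega> i) \<in> borel_measurable A"
    and "\<And>i. 1 \<le> i \<Longrightarrow> i < n \<Longrightarrow> (\<lambda>\<omega>. zt \<omega> i) \<in> borel_measurable A"
    and "\<And>i. 1 \<le> i \<Longrightarrow> i < n \<Longrightarrow> (\<lambda>\<omega>. v \<omega> i) \<in> borel_measurable A"
  shows "(\<lambda>\<omega>. thetahat P d \<alpha> \<gamma> \<beta> (th \<omega>) (z \<omega>) (zt \<omega>) (v \<omega>) n) \<in> borel_measurable A"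
  using assms(2-4)
proof (induction n)
  case (Suc n)
  note [measurable] = th
  show ?case
  proof (cases n)
    case 0
    have [measurable]: "(\<lambda>\<omega>. z \<omega> (Suc 0)) \<in> borel_measurable A" using Suc.prems(1)[of 1] by simp
    show ?thesis unfolding 0 thetahat.simps One_nat_def by measurable
  next
    case (Suc m)
    have [measurable]: "(\<lambda>\<omega>. z \<omega> (Suc (Suc m))) \<in> borel_measurable A"
      "(\<lambda>\<omega>. zt \<omega> (Suc m)) \<in> borel_measurable A" "(\<lambda>\<omega>. v \<omega> (Suc m)) \<in> borel_measurable A"
      using Suc.prems Suc by auto
    have [measurable]: "(\<lambda>\<omega>. thetahat P d \<alpha> \<gamma> \<beta> (th \<omega>) (z \<omega>) (zt \<omega>) (v \<omega>) (Suc m)) \<in> borel_measurable A"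
      using Suc.IH Suc.prems Suc by auto
    show ?thesis unfolding Suc thetahat.simps Let_def by measurable
  qed
qed simp

subsection \<open>Decoding errors\<close>

text \<open>The quantifier over PAM points is finite, the message lives on a discrete space, and
  each distance comparison relates two measurable functions.\<close>

lemma sets_decoding_error:
  "{\<omega> \<in> space (scheme_space M N \<sigma> \<sigma>t d). case \<omega> of (k, z, zt, v) \<Rightarrow>
      dec_error M (thetahat P d \<alpha> \<gamma> \<beta> (pam M k) z zt v N) k} \<in> sets (scheme_space M N \<sigma> \<sigma>t d)"
proof -
  let ?S = "scheme_space M N \<sigma> \<sigma>t d"
  define T where "T \<omega> = thetahat P d \<alpha> \<gamma> \<beta> (pam M (fst \<omega>)) (fst (snd \<omega>)) (fst (snd (snd \<omega>)))
      (snd (snd (snd \<omega>))) N" for \<omega>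
  have k: "fst \<in> ?S \<rightarrow>\<^sub>M count_space UNIV"
    unfolding scheme_space_def by measurable
  have pam: "(\<lambda>\<omega>. pam M (fst \<omega>)) \<in> borel_measurable ?S"
    by (rule measurable_compose[OF k]) simp
  have T: "T \<in> borel_measurable ?S"
    unfolding T_def
  proof (rule borel_measurable_thetahat[OF pam])
    show "(\<lambda>\<omega>. fst (snd \<omega>) i) \<in> borel_measurable ?S" if "1 \<le> i" "i \<le> N" for i
    proof -
      have "i \<in> {1..N}" using that by simp
      then show ?thesis unfolding scheme_space_def by measurable
    qed
    fix i assume "1 \<le> i" "i < N"
    then have "i \<in> {1..N-1}" by simp
    then show "(\<lambda>\<omega>. fst (snd (snd \<omega>)) i) \<in> borel_measurable ?S"
      "(\<lambda>\<omega>. snd (snd (snd \<omega>)) i) \<in> borel_measurable ?S"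
      unfolding scheme_space_def by measurable
  qed
  have "{\<omega> \<in> space ?S. \<exists>j\<in>{..<M}. j \<noteq> fst \<omega> \<and> \<bar>T \<omega> - pam M j\<bar> \<le> \<bar>T \<omega> - pam M (fst \<omega>)\<bar>} \<in> sets ?S"
  proof (rule sets.sets_Collect_finite_Ex)
    fix j
    have "{\<omega> \<in> space ?S. j \<noteq> fst \<omega>} = fst -` {k. j \<noteq> k} \<inter> space ?S" by auto
    then have "{\<omega> \<in> space ?S. j \<noteq> fst \<omega>} \<in> sets ?S"
      using measurable_sets[OF k, of "{k. j \<noteq> k}"] by simp
    moreover have "{\<omega> \<in> space ?S. \<bar>T \<omega> - pam M j\<bar> \<le> \<bar>T \<omega> - pam M (fst \<omega>)\<bar>} \<in> sets ?S"
      using T pam by measurable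
    ultimately show "{\<omega> \<in> space ?S. j \<noteq> fst \<omega> \<and> \<bar>T \<omega> - pam M j\<bar> \<le> \<bar>T \<omega> - pam M (fst \<omega>)\<bar>} \<in> sets ?S"
      by (intro sets.sets_Collect_conj)
  qed simp
  then show ?thesis
    unfolding dec_error_def case_prod_beta T_def Bex_def lessThan_iff .
qed

lemma pam_diff: "pam M k - pam M j = 2 * (real k - real j) * sqrt (3 / ((real M)\<^sup>2 - 1))"
  by (simp add: pam_def algebra_simps)

text \<open>Distinct PAM points are at least twice the root apart, so by the triangle inequality an
  estimate no closer to the sent point than to another is off by at least half that
  distance.\<close>

lemma dec_error_imp_large_error:
  assumes "dec_error M (pam M k + e) k"
  shows "sqrt (3 / ((real M)\<^sup>2 - 1)) \<le> \<bar>e\<bar>"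
proof -
  let ?\<eta> = "sqrt (3 / ((real M)\<^sup>2 - 1))"
  obtain j where j: "j < M" "j \<noteq> k" "\<bar>pam M k + e - pam M j\<bar> \<le> \<bar>e\<bar>"
    using assms by (auto simp: dec_error_def)
  \<comment> \<open>\<open>j < M\<close> excludes \<open>M = 0\<close>, where the radicand would be
    -3.\<close>
  have "1 \<le> (real M)\<^sup>2" using j(1) by simp
  then have "?\<eta> \<ge> 0" by simp
  moreover have "1 \<le> \<bar>real k - real j\<bar>" using j(2) by linarith
  ultimately have "2 * 1 * ?\<eta> \<le> 2 * \<bar>real k - real j\<bar> * ?\<eta>"
    by (intro mult_right_mono mult_left_mono) auto
  also have "\<dots> = \<bar>pam M k - pam M j\<bar>"
    using \<open>?\<eta> \<ge> 0\<close> unfolding pam_diff by (simp only: abs_mult abs_of_nonneg abs_numeral)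
  finally show ?thesis using j(3) by linarith
qed

text \<open>A union bound over N - 1 aliasing events and one large final error. The inclusion is
  pointwise, so no conditioning on the absence of aliasing disturbs the Gaussian laws. Here
  \<open>s\<close> stands for the standard deviations of the error and \<open>w\<close> for the
  common one at the modulo.\<close>

lemma decoding_error_prob_le:
  fixes P \<sigma> \<sigma>t d w :: real and N M :: nat and \<gamma> \<beta> s :: "nat \<Rightarrow> real"
  assumes pos: "P > 0" "\<sigma> > 0" "\<sigma>t > 0" "d > 0" "w > 0" and N: "N \<ge> 1" and s_pos: "s N > 0"
    and s1: "(s 1)\<^sup>2 = \<sigma>\<^sup>2 / P"
    and s_Suc: "\<And>m. 1 \<le> m \<Longrightarrow> (s (Suc m))\<^sup>2 =
        (1 - \<beta> (Suc m) * \<alpha> * \<gamma> m)\<^sup>2 * (s m)\<^sup>2 + (\<beta> (Suc m))\<^sup>2 * (\<alpha>\<^sup>2 * \<sigma>t\<^sup>2 + \<sigma>\<^sup>2)"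
    and w: "\<And>m. 1 \<le> m \<Longrightarrow> (\<gamma> m)\<^sup>2 * (s m)\<^sup>2 + \<sigma>t\<^sup>2 = w\<^sup>2"
  defines "E \<equiv> {\<omega> \<in> space (scheme_space M N \<sigma> \<sigma>t d). case \<omega> of (k, z, zt, v) \<Rightarrow>
      dec_error M (thetahat P d \<alpha> \<gamma> \<beta> (pam M k) z zt v N) k}"
  shows "measure (scheme_space M N \<sigma> \<sigma>t d) E \<le>
    (real N - 1) * (2 * Qfun (d / 2 / w)) + 2 * Qfun (sqrt (3 / ((real M)\<^sup>2 - 1)) / s N)"
proof -
  let ?S = "scheme_space M N \<sigma> \<sigma>t d" and ?\<eta> = "sqrt (3 / ((real M)\<^sup>2 - 1))"
  interpret S: prob_space ?S
    using pos by (intro prob_space_scheme_space)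
  \<comment> \<open>Formulated with \<open>lin_err\<close> rather than the real estimate, so it
    stays a Gaussian tail event even if aliasing occurred earlier.\<close>
  define B where "B n = {\<omega> \<in> space ?S. case \<omega> of (k, z, zt, v) \<Rightarrow>
      d / 2 \<le> \<bar>\<gamma> n * lin_err P \<alpha> \<gamma> \<beta> z zt n + zt n\<bar>}" for n
  define C where "C = {\<omega> \<in> space ?S. case \<omega> of (k, z, zt, v) \<Rightarrow> ?\<eta> \<le> \<bar>lin_err P \<alpha> \<gamma> \<beta> z zt N\<bar>}"
  have B: "B n \<in> sets ?S \<and> measure ?S (B n) \<le> 2 * Qfun (d / 2 / w)" if "n \<in> {1..<N}" for n
  proof -
    have n: "1 \<le> n" "n < N" using that by auto
    obtain a b where f: "\<And>z zt. \<gamma> n * lin_err P \<alpha> \<gamma> \<beta> z zt n + zt n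
        = (\<Sum>i\<in>{1..N}. a i * z i) + (\<Sum>i\<in>{1..N-1}. b i * zt i)"
      and v: "\<sigma>\<^sup>2 * (\<Sum>i\<in>{1..N}. (a i)\<^sup>2) + \<sigma>t\<^sup>2 * (\<Sum>i\<in>{1..N-1}. (b i)\<^sup>2) = (\<gamma> n)\<^sup>2 * (s n)\<^sup>2 + \<sigma>t\<^sup>2"
      by (rule aliasing_coefficients[where V = "\<lambda>n. (s n)\<^sup>2", OF n pos(1) s1 s_Suc])
        (assumption, rule that)
    show ?thesis
      unfolding B_def using scheme_space_linear_tail[OF pos(2-4) f v[unfolded w[OF n(1)]] pos(5)]
      by blast
  qed
  have C: "C \<in> sets ?S \<and> measure ?S C \<le> 2 * Qfun (?\<eta> / s N)"
  proof -
    obtain a b where f: "\<And>z zt. lin_err P \<alpha> \<gamma> \<beta> z zt N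
        = (\<Sum>i\<in>{1..N}. a i * z i) + (\<Sum>i\<in>{1..N-1}. b i * zt i)"
      and v: "\<sigma>\<^sup>2 * (\<Sum>i\<in>{1..N}. (a i)\<^sup>2) + \<sigma>t\<^sup>2 * (\<Sum>i\<in>{1..N-1}. (b i)\<^sup>2) = (s N)\<^sup>2"
      by (rule lin_err_coefficients[where V = "\<lambda>n. (s n)\<^sup>2", OF N order_refl pos(1) s1 s_Suc])
        (assumption, rule that)
    show ?thesis
      unfolding C_def using scheme_space_linear_tail[OF pos(2-4) f v s_pos] by blast
  qed
  have "E \<subseteq> (\<Union>n\<in>{1..<N}. B n) \<union> C"
  proof
    fix \<omega> assume "\<omega> \<in> E"
    then obtain k z zt v where \<omega>: "\<omega> = (k, z, zt, v)" "\<omega> \<in> space ?S"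
      and err: "dec_error M (thetahat P d \<alpha> \<gamma> \<beta> (pam M k) z zt v N) k"
      by (cases \<omega>) (auto simp: E_def)
    show "\<omega> \<in> (\<Union>n\<in>{1..<N}. B n) \<union> C"
    proof (cases "\<omega> \<in> (\<Union>n\<in>{1..<N}. B n)")
      case False
      then have "\<bar>\<gamma> i * lin_err P \<alpha> \<gamma> \<beta> z zt i + zt i\<bar> < d / 2" if "1 \<le> i" "i < N" for i
        using that \<omega> by (auto simp: B_def not_le)
      then have "thetahat P d \<alpha> \<gamma> \<beta> (pam M k) z zt v N = pam M k + lin_err P \<alpha> \<gamma> \<beta> z zt N"
        using pos N by (intro thetahat_eq_lin_err) auto
      then have "\<omega> \<in> C"
        using dec_error_imp_large_error err \<omega> by (simp add: C_def)
      then show ?thesis by simp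
    qed simp
  qed
  moreover have UB: "(\<Union>n\<in>{1..<N}. B n) \<in> sets ?S"
    using B by (intro sets.finite_UN) auto
  ultimately have "measure ?S E \<le> measure ?S ((\<Union>n\<in>{1..<N}. B n) \<union> C)"
    using C by (intro S.finite_measure_mono) auto
  also have "\<dots> \<le> measure ?S (\<Union>n\<in>{1..<N}. B n) + measure ?S C"
    using UB C by (intro measure_Un_le) auto
  also have "measure ?S (\<Union>n\<in>{1..<N}. B n) \<le> (\<Sum>n\<in>{1..<N}. measure ?S (B n))"
    using B by (intro measure_UNION_le) auto
  also have "\<dots> \<le> (\<Sum>n\<in>{1..<N}. 2 * Qfun (d / 2 / w))"
    using B by (intro sum_mono) auto
  also have "\<dots> = (real N - 1) * (2 * Qfun (d / 2 / w))"
    using N by (simp add: of_nat_diff)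
  finally show ?thesis using C by linarith
qed

text \<open>For M = 1 the PAM points collapse (3 / 0 = 0), and labels k > 0, which lie in the space of the
  message law but carry no mass, satisfy dec_error.\<close>

lemma decoding_error_prob_single_message:
  fixes \<sigma> \<sigma>t d :: real
  assumes "\<sigma> > 0" "\<sigma>t > 0" "d > 0"
  shows "measure (scheme_space 1 N \<sigma> \<sigma>t d) {\<omega> \<in> space (scheme_space 1 N \<sigma> \<sigma>t d).
    case \<omega> of (k, z, zt, v) \<Rightarrow> dec_error 1 (thetahat P d \<alpha> \<gamma> \<beta> (pam 1 k) z zt v N) k} = 0"
proof -
  let ?K = "measure_pmf (pmf_of_set {..<1::nat})"
  let ?R = "PiM {1..N} (\<lambda>_. gauss \<sigma>) \<Otimes>\<^sub>M (PiM {1..N-1} (\<lambda>_. gauss \<sigma>t) \<Otimes>\<^sub>M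
        PiM {1..N-1} (\<lambda>_::nat. uniform_measure lborel {-d/2..<d/2}))"
  let ?S = "scheme_space 1 N \<sigma> \<sigma>t d"
  have S: "?S = ?K \<Otimes>\<^sub>M ?R" by (rule scheme_space_gauss[OF assms(1,2)])
  interpret R: prob_space ?R
    by (intro prob_space_pair prob_space_PiM prob_space_gauss prob_space_dither assms)
  interpret S: prob_space ?S
    by (rule prob_space_scheme_space[OF assms])
  have fst: "fst \<in> ?S \<rightarrow>\<^sub>M ?K" unfolding S by (rule measurable_fst)
  have "measure ?S {\<omega> \<in> space ?S. case \<omega> of (k, z, zt, v) \<Rightarrow>
      dec_error 1 (thetahat P d \<alpha> \<gamma> \<beta> (pam 1 k) z zt v N) k} \<le> measure ?S (fst -` (- {0}) \<inter> space ?S)"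
    by (intro S.finite_measure_mono measurable_sets[OF fst]) (auto simp: dec_error_def)
  also have "\<dots> = measure (distr ?S ?K fst) (- {0})"
    by (rule measure_distr[OF fst, symmetric]) simp
  also have "\<dots> = measure ?K (- {0})"
    unfolding S by (simp only: R.distr_pair_fst)
  also have "\<dots> = 0"
    by (subst measure_pmf_of_set) auto
  finally show ?thesis by (simp add: measure_le_0_iff)
qed

section \<open>Parameters of the scheme, error probability and capacity gap\<close>

theorem theorem1:
  fixes P \<sigma> Pt \<sigma>t pe :: real and N :: nat
  assumes hP: "P > 0" and h\<sigma>: "\<sigma> > 0" and hPt: "Pt > 0" and h\<sigma>t: "\<sigma>t > 0"
  defines "snr \<equiv> P / \<sigma>^2"
      and "snrt \<equiv> Pt / \<sigma>t^2"
  defines "\<Delta> \<equiv> snrt / snr"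
  assumes h\<Delta>: "\<Delta> > 1" and hpe: "0 < pe" "pe < 1" and hN: "N \<ge> 1"
  defines "L \<equiv> (Qinv (pe / (4 * real N)))^2 / 3"
  assumes hL: "L < snrt"
  defines "d \<equiv> sqrt (12 * Pt)"
      and "sig \<equiv> \<lambda>n::nat. sqrt ((1 / snr) *
              (1 + snr * (1 - L / snrt) / (1 + L / \<Delta>)) powr (1 - real n))"
  defines "\<alpha> \<equiv> sqrt (L * P / Pt)"
      and "\<gamma> \<equiv> \<lambda>n::nat. (1 / sig n) * sqrt (Pt / L - \<sigma>t^2)"
      and "\<beta> \<equiv> \<lambda>n::nat. (sig (n - 1) / \<sigma>) * (sqrt (snr * (1 - L / snrt)) / (1 + snr))"
      and "snrN \<equiv> 1 / (sig N)^2"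
  defines "Rs \<equiv> 1 / (2 * real N) * log 2 (1 + snrN / Gamma0 (pe / 2))"
  defines "\<Psi>1 \<equiv> 1 + L / \<Delta>"
      and "\<Psi>2 \<equiv> 1 / (1 - L / snrt)"
  defines "den \<equiv> snr * \<Psi>1 powr (- (real N - 1) / real N) * \<Psi>2 powr (- (real N - 1) / real N)
                   * Gamma0 (pe / 2) powr (- 1 / real N) - 1"
  defines "\<Psi>3 \<equiv> (10 / ln 10) / den"
  shows "(\<forall>(M::nat) (R::real). real M = 2 powr (real N * R) \<and> R \<le> Rs \<longrightarrow>
            (let \<Omega> = scheme_space M N \<sigma> \<sigma>t d;
                 E = {\<omega> \<in> space \<Omega>. case \<omega> of (k, z, zt, v) \<Rightarrow>
                        dec_error M (thetahat P d \<alpha> \<gamma> \<beta> (pam M k) z zt v N) k}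
             in E \<in> sets \<Omega> \<and> measure \<Omega> E \<le> pe))
       \<and> (den > 0 \<longrightarrow>
            dB (snr / (2 powr (2 * Rs) - 1))
              < dB (Gamma0 (pe / 2)) / real N
                + ((real N - 1) / real N) * (dB \<Psi>1 + dB \<Psi>2) + \<Psi>3)"
proof -
  \<comment> \<open>\<open>a\<close> is the share of the variance \<open>Pt / L\<close> at the
    modulo that stems from the estimation error; \<open>r\<close> is the factor by which the error
    variance shrinks per round.\<close>
  define a where "a = 1 - L / snrt"
  define r where "r = 1 + snr * a / (1 + L / \<Delta>)"
  have snr: "snr > 0" and snrt: "snrt > 0" using assms(1-4) by (simp_all add: snr_def snrt_def)
  have p_alias: "0 < pe / (4 * real N)" "pe / (4 * real N) < 1 / 2"
    using hpe hN by (auto simp: field_simps)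
  \<comment> \<open>\<open>Gamma0\<close> halves its argument once more, so
    \<open>Gamma0 (pe / 2)\<close> involves \<open>Qinv\<close> at pe / 4.\<close>
  have p_dec: "0 < pe / 2 / 2" "pe / 2 / 2 < 1 / 2" using hpe by auto
  have L: "L > 0" using Qinv_pos[OF p_alias] by (simp add: L_def)
  have a: "0 < a" "a < 1" using L snrt hL by (auto simp: a_def)
  have \<Delta>: "\<Delta> > 0" using snr snrt by (simp add: \<Delta>_def)
  have LD: "L / \<Delta> = snr * (1 - a)" by (simp add: \<Delta>_def a_def)
  have b: "1 + L / \<Delta> > 1" using L \<Delta> by simp
  \<comment> \<open>Since \<open>L / \<Delta> = snr * (1 - a)\<close>, the numerator
    \<open>1 + L / \<Delta> + snr * a\<close> collapses to \<open>1 + snr\<close>.\<close>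
  have r: "r = (1 + snr) / (1 + L / \<Delta>)"
    using b unfolding r_def by (simp add: field_simps) (simp add: LD algebra_simps)
  have r_gt: "r > 1" using snr a b by (simp add: r_def)
  have \<Gamma>: "Gamma0 (pe / 2) > 0" using Qinv_pos[OF p_dec] by (simp add: Gamma0_def)
  have sig2: "(sig n)\<^sup>2 = 1 / snr * r powr (1 - real n)" for n
    using snr by (simp add: sig_def r_def a_def)
  have sig_pos: "sig n > 0" for n
    using snr r_gt by (simp add: sig_def flip: a_def r_def)
  have sig_Suc: "(sig (Suc n))\<^sup>2 = (sig n)\<^sup>2 / r" for n
  proof -
    have "r powr (1 - real (Suc n)) = r powr (1 - real n) / r"
      using r_gt powr_diff[of r "1 - real n" 1] by (simp add: algebra_simps)
    then show ?thesis unfolding sig2 by simp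
  qed
  have snrN: "snrN = snr * r ^ (N - 1)"
  proof -
    have "1 - real N = - real (N - 1)" using hN by (simp add: of_nat_diff)
    then have "r powr (1 - real N) = 1 / r ^ (N - 1)"
      using r_gt by (simp only: powr_minus_divide powr_realpow)
    then show ?thesis by (simp add: snrN_def sig2)
  qed
  have snrN_pos: "snrN > 0" using snr r_gt by (simp add: snrN)
  have Rs: "2 powr (2 * real N * Rs) = 1 + snrN / Gamma0 (pe / 2)"
  proof -
    have "2 * real N * Rs = log 2 (1 + snrN / Gamma0 (pe / 2))"
      using hN by (simp add: Rs_def)
    moreover have "1 + snrN / Gamma0 (pe / 2) > 0" using snrN_pos \<Gamma> by (simp add: add_pos_pos)
    ultimately show ?thesis by simp
  qed

  have d: "d > 0" using hPt by (simp add: d_def)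
  have G: "Pt / L - \<sigma>t\<^sup>2 = Pt / L * a"
    using L snrt hPt h\<sigma>t by (simp add: a_def snrt_def field_simps)
  have G_nonneg: "Pt / L * a \<ge> 0" using hPt L a by simp
  have w_pos: "sqrt (Pt / L) > 0" using hPt L by simp
  have \<gamma>2: "(\<gamma> n)\<^sup>2 * (sig n)\<^sup>2 + \<sigma>t\<^sup>2 = (sqrt (Pt / L))\<^sup>2" for n
  proof -
    have "(\<gamma> n)\<^sup>2 * (sig n)\<^sup>2 = Pt / L - \<sigma>t\<^sup>2"
      using sig_pos[of n] G G_nonneg by (simp add: \<gamma>_def power_mult_distrib power_divide)
    then show ?thesis using hPt L by simp
  qed
  have \<beta>: "\<beta> (Suc n) = sig n * (sqrt (snr * a) / (\<sigma> * (1 + snr)))" for n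
    by (simp add: \<beta>_def a_def)
  \<comment> \<open>\<open>\<alpha>\<close> scales the variance \<open>Pt / L\<close> to the power
    \<open>P\<close>, of which the error contributes \<open>P * a\<close>.\<close>
  have \<alpha>\<gamma>: "\<alpha> * \<gamma> n = sqrt P * sqrt a / sig n" for n
  proof -
    have "\<alpha> * \<gamma> n = sqrt (L * P / Pt * (Pt / L * a)) / sig n"
      unfolding \<alpha>_def \<gamma>_def G by (simp only: real_sqrt_mult) simp
    also have "L * P / Pt * (Pt / L * a) = P * a" using L hPt by simp
    finally show ?thesis by (simp add: real_sqrt_mult)
  qed
  have sqrt_snr: "sqrt snr = sqrt P / \<sigma>" using h\<sigma> by (simp add: snr_def real_sqrt_divide)
  have \<beta>\<alpha>\<gamma>: "\<beta> (Suc n) * \<alpha> * \<gamma> n = snr * a / (1 + snr)" for n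
  proof -
    have "\<beta> (Suc n) * \<alpha> * \<gamma> n = \<beta> (Suc n) * (\<alpha> * \<gamma> n)" by simp
    also have "\<dots> = (sqrt P / \<sigma> * sqrt snr) * (sqrt a * sqrt a) / (1 + snr)"
      using sig_pos[of n] unfolding \<alpha>\<gamma> \<beta> by (simp add: real_sqrt_mult)
    also have "\<dots> = snr * a / (1 + snr)"
      using snr a unfolding sqrt_snr[symmetric] by simp
    finally show ?thesis .
  qed
  \<comment> \<open>In the linear system \<open>\<beta> (Suc n)\<close> is the covariance of error
    and received signal, \<open>sqrt (P * a) * sig n\<close>, over the variance
    \<open>\<sigma>\<^sup>2 * (1 + snr)\<close> of that signal: the linear least-squares
    coefficient.\<close>
  have sig_rec: "(sig (Suc n))\<^sup>2 = (1 - \<beta> (Suc n) * \<alpha> * \<gamma> n)\<^sup>2 * (sig n)\<^sup>2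
      + (\<beta> (Suc n))\<^sup>2 * (\<alpha>\<^sup>2 * \<sigma>t\<^sup>2 + \<sigma>\<^sup>2)" for n
  proof -
    have "\<alpha>\<^sup>2 * \<sigma>t\<^sup>2 = \<sigma>\<^sup>2 * (snr * (1 - a))"
      using L hP hPt h\<sigma> h\<sigma>t by (simp add: \<alpha>_def a_def snr_def snrt_def)
    then have noise: "\<alpha>\<^sup>2 * \<sigma>t\<^sup>2 + \<sigma>\<^sup>2 = \<sigma>\<^sup>2 * (1 + snr * (1 - a))"
      by (simp add: algebra_simps)
    have \<beta>2: "(\<beta> (Suc n))\<^sup>2 = (sig n)\<^sup>2 * (snr * a / (\<sigma>\<^sup>2 * (1 + snr)\<^sup>2))"
      using snr a unfolding \<beta> by (simp add: power_mult_distrib power_divide)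
    \<comment> \<open>In these variables the claim reads
      \<open>(1 - x / t)\<^sup>2 + x * (t - x) / t\<^sup>2 = (t - x) / t\<close>, and the right-hand
      side is \<open>1 / r\<close>.\<close>
    define t where "t = 1 + snr"
    define x where "x = snr * a"
    have t: "t > 0" using snr by (simp add: t_def)
    have tx: "1 + snr * (1 - a) = t - x" by (simp add: t_def x_def algebra_simps)
    have "(1 - x / t)\<^sup>2 + x * (t - x) / t\<^sup>2 = ((t - x)\<^sup>2 + x * (t - x)) / t\<^sup>2"
      using t by (simp add: diff_divide_eq_iff power_divide add_divide_distrib)
    also have "(t - x)\<^sup>2 + x * (t - x) = (t - x) * t" by algebra
    also have "(t - x) * t / t\<^sup>2 = 1 / r"
      unfolding r LD tx using t by (simp add: power2_eq_square flip: t_def)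
    finally have "1 / r = (1 - x / t)\<^sup>2 + x * (t - x) / t\<^sup>2" ..
    then have "(sig n)\<^sup>2 / r = (1 - x / t)\<^sup>2 * (sig n)\<^sup>2 + (sig n)\<^sup>2 * (x * (t - x) / t\<^sup>2)"
      by (metis distrib_left mult.commute mult.right_neutral times_divide_eq_right)
    then show ?thesis
      unfolding sig_Suc \<beta>\<alpha>\<gamma> noise \<beta>2 tx using h\<sigma> by (simp flip: t_def x_def)
  qed
  have sig_1: "(sig 1)\<^sup>2 = \<sigma>\<^sup>2 / P" using r_gt by (simp add: sig2 snr_def)

  \<comment> \<open>Half the modulo interval is \<open>sqrt (3 * Pt)\<close>; divided by
    \<open>sqrt (Pt / L)\<close> it is \<open>sqrt (3 * L)\<close>, which is
    \<open>Qinv (pe / (4 * real N))\<close> by the choice of \<open>L\<close>.\<close>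
  have Q_alias: "2 * Qfun (d / 2 / sqrt (Pt / L)) = pe / (2 * real N)"
  proof -
    have "(d / 2 / sqrt (Pt / L))\<^sup>2 = (Qinv (pe / (4 * real N)))\<^sup>2"
      using hPt L by (simp add: d_def power_divide L_def)
    then have "d / 2 / sqrt (Pt / L) = Qinv (pe / (4 * real N))"
      using d hPt L Qinv_pos[OF p_alias] by (subst (asm) power2_eq_iff_nonneg) auto
    then show ?thesis using Qfun_Qinv[OF p_alias] by simp
  qed

  have part_a: "measure (scheme_space M N \<sigma> \<sigma>t d) {\<omega> \<in> space (scheme_space M N \<sigma> \<sigma>t d).
      case \<omega> of (k, z, zt, v) \<Rightarrow> dec_error M (thetahat P d \<alpha> \<gamma> \<beta> (pam M k) z zt v N) k} \<le> pe"
    if M: "real M = 2 powr (real N * R)" and R: "R \<le> Rs" for M R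
  \<comment> \<open>For \<open>M = 1\<close> the half distance evaluates to 0 and the general bound
    would be at least 1.\<close>
  proof (cases "M = 1")
    case True
    show ?thesis
      unfolding True using decoding_error_prob_single_message[OF h\<sigma> h\<sigma>t d] hpe by simp
  next
    case False
    have "real M > 0" unfolding M by simp
    with False have M2: "real M \<ge> 2" by auto
    then have M1: "(real M)\<^sup>2 > 1" by (simp add: power2_eq_square less_1_mult)
    have "(real M)\<^sup>2 = 2 powr (2 * real N * R)"
      unfolding M power2_eq_square powr_add[symmetric] by (simp add: algebra_simps)
    also have "\<dots> \<le> 2 powr (2 * real N * Rs)" using R by (simp add: mult_left_mono)
    finally have "(real M)\<^sup>2 - 1 \<le> snrN / Gamma0 (pe / 2)" unfolding Rs by simp
    then have "Gamma0 (pe / 2) \<le> snrN / ((real M)\<^sup>2 - 1)"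
      using M1 \<Gamma> by (simp add: field_simps)
    \<comment> \<open>The rate condition multiplied by 3: the right-hand side is half the PAM
      distance in units of the final standard deviation, squared.\<close>
    then have "(Qinv (pe / 2 / 2))\<^sup>2 \<le> (sqrt (3 / ((real M)\<^sup>2 - 1)) / sig N)\<^sup>2"
      using M1 by (simp add: Gamma0_def snrN_def power_divide field_simps)
    then have "Qinv (pe / 2 / 2) \<le> sqrt (3 / ((real M)\<^sup>2 - 1)) / sig N"
      using M1 sig_pos[of N] by (auto elim!: power2_le_imp_le)
    then have "Qfun (sqrt (3 / ((real M)\<^sup>2 - 1)) / sig N) \<le> Qfun (Qinv (pe / 2 / 2))"
      by (rule Qfun_antimono)
    then have "Qfun (sqrt (3 / ((real M)\<^sup>2 - 1)) / sig N) \<le> pe / 4"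
      using Qfun_Qinv[OF p_dec] by simp
    then have "measure (scheme_space M N \<sigma> \<sigma>t d) {\<omega> \<in> space (scheme_space M N \<sigma> \<sigma>t d).
        case \<omega> of (k, z, zt, v) \<Rightarrow> dec_error M (thetahat P d \<alpha> \<gamma> \<beta> (pam M k) z zt v N) k}
        \<le> (real N - 1) * (pe / (2 * real N)) + pe / 2"
      using decoding_error_prob_le[where s = sig and w = "sqrt (Pt / L)" and M = M,
          OF hP h\<sigma> h\<sigma>t d w_pos hN sig_pos sig_1 sig_rec \<gamma>2]
      unfolding Q_alias by linarith
    \<comment> \<open>The sum equals \<open>pe - pe / (2 * real N)\<close>.\<close>
    also have "\<dots> \<le> pe"
      using hN hpe by (simp add: field_simps)
    finally show ?thesis .
  qed

  have part_b: "dB (snr / (2 powr (2 * Rs) - 1))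
      < dB (Gamma0 (pe / 2)) / real N + ((real N - 1) / real N) * (dB \<Psi>1 + dB \<Psi>2) + \<Psi>3"
    if den: "den > 0"
  proof -
    define g where "g = Gamma0 (pe / 2)"
    define q where "q = (real N - 1) / real N"
    define c where "c = 10 / ln (10::real)"
    have c: "c > 0" by (simp add: c_def)
    have dB: "dB x = c * ln x" for x by (simp add: dB_def log_def c_def)
    have g: "g > 0" using \<Gamma> by (simp add: g_def)
    have \<Psi>: "\<Psi>1 > 0" "\<Psi>2 > 0" using b a by (simp_all add: \<Psi>1_def \<Psi>2_def flip: a_def)
    have D: "den + 1 = snr * \<Psi>1 powr (- q) * \<Psi>2 powr (- q) * g powr (- 1 / real N)"
    proof -
      have "- (real N - 1) / real N = - q" unfolding q_def by (rule minus_divide_left[symmetric])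
      then show ?thesis by (simp only: den_def g_def diff_add_cancel)
    qed
    have lnD: "ln (den + 1) = ln snr - q * (ln \<Psi>1 + ln \<Psi>2) - ln g / real N"
      unfolding D using snr \<Psi> g by (simp add: ln_mult ln_powr algebra_simps)
    \<comment> \<open>\<open>r\<close> is 1 plus \<open>snr / (\<Psi>1 * \<Psi>2)\<close>; the
      summand 1 is dropped.\<close>
    have r_ge: "ln r \<ge> ln snr - ln \<Psi>1 - ln \<Psi>2"
    proof -
      have "ln snr - ln \<Psi>1 - ln \<Psi>2 = ln (snr * a / \<Psi>1)"
        using snr a \<Psi> by (simp add: \<Psi>2_def ln_mult ln_div flip: a_def)
      also have "\<dots> \<le> ln r" using snr a \<Psi> unfolding r_def \<Psi>1_def[symmetric] by (intro ln_mono) auto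
      finally show ?thesis .
    qed
    have "ln (den + 1) \<le> (ln snrN - ln g) / real N"
    proof -
      have "ln snrN = ln snr + (real N - 1) * ln r"
        using snr r_gt hN by (simp add: snrN ln_mult ln_realpow of_nat_diff)
      moreover have "(real N - 1) * (ln snr - ln \<Psi>1 - ln \<Psi>2) \<le> (real N - 1) * ln r"
        using r_ge hN by (intro mult_left_mono) auto
      ultimately have "ln snr + (real N - 1) * (ln snr - ln \<Psi>1 - ln \<Psi>2) \<le> ln snrN"
        by simp
      moreover have "real N * ln (den + 1)
          = real N * ln snr - (real N - 1) * (ln \<Psi>1 + ln \<Psi>2) - ln g"
      proof -
        have "real N * q = real N - 1" using hN by (simp add: q_def)
        then show ?thesis using hN by (simp add: lnD right_diff_distrib flip: mult.assoc)
      qed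
      ultimately have "real N * ln (den + 1) \<le> ln snrN - ln g"
        by (simp add: algebra_simps)
      then show ?thesis using hN by (simp add: pos_le_divide_eq mult.commute)
    qed
    also have "\<dots> = ln (snrN / g) / real N" using snrN_pos g by (simp add: ln_div)
    \<comment> \<open>The strictness of the final inequality comes from here, also for
      \<open>N = 1\<close>, where the bound on \<open>r\<close> enters with weight 0.\<close>
    also have "\<dots> < ln (1 + snrN / g) / real N"
    proof (rule divide_strict_right_mono)
      have "0 < snrN / g" using snrN_pos g by simp
      then show "ln (snrN / g) < ln (1 + snrN / g)"
        by (subst ln_less_cancel_iff) auto
    qed (use hN in simp)
    also have "\<dots> = ln (2 powr (2 * Rs))"
      using Rs[folded g_def, symmetric] hN by (simp add: ln_powr)
    finally have "den < 2 powr (2 * Rs) - 1"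
      using den by (subst (asm) ln_less_cancel_iff) auto
    then have "ln (snr / (2 powr (2 * Rs) - 1)) < ln (snr / den)"
      using den snr by (subst ln_less_cancel_iff) (auto intro!: divide_strict_left_mono mult_pos_pos)
    \<comment> \<open>\<open>den + 1\<close> is a pure product, so its logarithm supplies the main
      terms; the correction is at most \<open>1 / den\<close>, which becomes \<open>\<Psi>3\<close>
      after scaling by \<open>c\<close>.\<close>
    also have "ln (snr / den) = ln snr - ln (den + 1) + ln (1 + 1 / den)"
    proof -
      have "1 + 1 / den = (den + 1) / den" using den by (simp add: field_simps)
      then show ?thesis using den snr by (simp add: ln_div)
    qed
    also have "\<dots> \<le> ln g / real N + q * (ln \<Psi>1 + ln \<Psi>2) + 1 / den"
      unfolding lnD using ln_add_one_self_le_self[of "1 / den"] den by simp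
    finally have "c * ln (snr / (2 powr (2 * Rs) - 1))
        < c * (ln g / real N + q * (ln \<Psi>1 + ln \<Psi>2) + 1 / den)"
      using c by (rule mult_strict_left_mono)
    then show ?thesis
      unfolding \<Psi>3_def dB q_def[symmetric] g_def[symmetric] c_def[symmetric]
      by (simp add: algebra_simps)
  qed

  show ?thesis
    unfolding Let_def
  proof (intro conjI allI impI)
    fix M R assume "real M = 2 powr (real N * R) \<and> R \<le> Rs"
    then show "measure (scheme_space M N \<sigma> \<sigma>t d) {\<omega> \<in> space (scheme_space M N \<sigma> \<sigma>t d).
        case \<omega> of (k, z, zt, v) \<Rightarrow> dec_error M (thetahat P d \<alpha> \<gamma> \<beta> (pam M k) z zt v N) k} \<le> pe"
      using part_a by blast
  qed (rule sets_decoding_error, rule part_b)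
qed

end
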